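(* Let $p$ be a prime and let $\omega \in \mathbf{C}$ be a primitive $p$th root of unity. Let $\mathbf{F}_p$ denote the field with $p$ elements. For any sets $I, J \subseteq \mathbf{F}_p$ with equal cardinality $|I| = |J|$, the matrix $(\omega^{ij})_{i \in I, j \in J}$ has non-zero determinant.
   Context: For $i, j \in \mathbf{F}_p$, the power $\omega^{ij}$ is well defined because $\omega^p = 1$: it means $\omega^{n}$ for any integer $n$ representing the residue class $ij \in \mathbf{F}_p = \mathbf{Z}/p\mathbf{Z}$. The rows of the matrix are indexed by $I$ and the columns by $J$, with arbitrary orderings chosen on $I$ and $J$; the choice affects the determinant only up to sign, so whether it vanishes does not depend on it. *)

theory Defs
  imports "HOL-Number_Theory.Residues" "Jordan_Normal_Form.Determinant" Complex_Main
begin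

definition primitive_root_of_unity :: "nat \<Rightarrow> complex \<Rightarrow> bool" where
  "primitive_root_of_unity n w \<longleftrightarrow> n > 0 \<and> w ^ n = 1 \<and> (\<forall>k. 0 < k \<and> k < n \<longrightarrow> w ^ k \<noteq> 1)"

abbreviation prime_field :: "nat \<Rightarrow> int ring" where
  "prime_field p \<equiv> residue_ring (int p)"

text \<open>
  The carrier of \<^term>\<open>prime_field p\<close> is \<open>{0..int p - 1}\<close>, so a residue class is itself an integer
  and can be used as an exponent. The next lemma shows that the power does not depend on this
  choice of representative of the product.
\<close>

lemma power_residue_well_defined:
  assumes "primitive_root_of_unity p w"
    and "[n = i * j] (mod int p)"
  shows "w powi n = w powi (i \<otimes>\<^bsub>prime_field p\<^esub> j)"
proof -
  have nz: "w \<noteq> 0" and one: "w ^ p = 1"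
    using assms(1) by (auto simp: primitive_root_of_unity_def power_0_left)
  have red: "w powi m = w powi (m mod int p)" for m
  proof -
    have "w powi m = w powi (int p * (m div int p) + m mod int p)"
      by simp
    also have "\<dots> = (w powi int p) powi (m div int p) * w powi (m mod int p)"
      by (subst power_int_add) (simp_all only: nz power_int_mult simp_thms not_False_eq_True)
    also have "w powi int p = 1"
      using one by simp
    finally show ?thesis by simp
  qed
  have "i \<otimes>\<^bsub>prime_field p\<^esub> j = n mod int p"
    using assms(2) by (simp add: residue_ring_def cong_def)
  with red show ?thesis by simp
qed

text \<open>
  The matrix \<open>(w\<^sup>i\<^sup>j)\<close> with \<open>i \<in> I\<close> and \<open>j \<in> J\<close>, where \<open>r\<close> and \<open>c\<close> are the orderings of the rows and
  of the columns: \<open>r\<close> enumerates \<open>I\<close> over \<open>{..<card I}\<close> and \<open>c\<close> enumerates \<open>J\<close> over \<open>{..<card J}\<close>.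
\<close>

definition fourier_submatrix ::
  "nat \<Rightarrow> complex \<Rightarrow> int set \<Rightarrow> int set \<Rightarrow> (nat \<Rightarrow> int) \<Rightarrow> (nat \<Rightarrow> int) \<Rightarrow> complex mat" where
  "fourier_submatrix p w I J r c =
     mat (card I) (card J) (\<lambda>(a, b). w powi (r a \<otimes>\<^bsub>prime_field p\<^esub> c b))"

end

theory Submission
  imports Defs "Jordan_Normal_Form.Char_Poly"
begin

text \<open>
  Newton interpolation factors the generalised Vandermonde matrix \<open>(x\<^sub>a\<^sup>e\<^sup>(\<^sup>b\<^sup>))\<close> into a triangular
  matrix with diagonal entries \<open>\<Prod>k<a. x\<^sub>a - x\<^sub>k\<close> and the matrix of divided differences of monomials.
  For \<open>x\<^sub>a = \<omega>\<^sup>i\<close>, with \<open>i\<close> the \<open>a\<close>-th element of \<open>I\<close>, the determinant of the latter is \<open>G(\<omega>)\<close> for an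
  integer polynomial \<open>G\<close>, and \<open>G(1)\<close> is the determinant of the binomial coefficients \<open>e(b)\<close> over \<open>a\<close>.
  Up to a product of factorials this is the Vandermonde determinant of the residues \<open>e(b)\<close>, so \<open>p\<close>
  does not divide \<open>G(1)\<close>. But \<open>G(\<omega>) = 0\<close> would imply that \<open>p\<close> divides \<open>G(1)\<close>.
\<close>

section \<open>Divided differences of monomials\<close>

text \<open>\<open>divdiff x a j\<close> is the divided difference of the monomial of degree \<open>j\<close> at the nodes
  \<open>x 0, \<dots>, x a\<close>, i.e. the complete homogeneous symmetric polynomial of degree \<open>j - a\<close> in these
  nodes (and \<open>0\<close> if \<open>j < a\<close>). The recursion makes sense even when nodes coincide.\<close>

fun divdiff :: "(nat \<Rightarrow> 'a::comm_ring_1) \<Rightarrow> nat \<Rightarrow> nat \<Rightarrow> 'a" where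
  "divdiff x 0 j = x 0 ^ j"
| "divdiff x (Suc a) 0 = 0"
| "divdiff x (Suc a) (Suc j) = divdiff x a j + x (Suc a) * divdiff x (Suc a) j"

definition newton_basis :: "(nat \<Rightarrow> 'a::comm_ring_1) \<Rightarrow> nat \<Rightarrow> 'a \<Rightarrow> 'a" where
  "newton_basis x a y = (\<Prod>k<a. y - x k)"

lemma divdiff_eq_0: "j < a \<Longrightarrow> divdiff x a j = 0"
  by (induction x a j rule: divdiff.induct) auto

lemma divdiff_diag: "divdiff x a a = 1"
  by (induction a) (auto simp: divdiff_eq_0)

text \<open>When all nodes equal 1, the recursion is Pascal's rule; this is the source of the
  binomial coefficients in G(1).\<close>

lemma divdiff_const_1: "divdiff (\<lambda>_. 1) a j = of_nat (j choose a)"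
  by (induction "\<lambda>_::nat. 1::'a" a j rule: divdiff.induct) auto

text \<open>Divided differences are integer polynomials in the nodes, so a single determinant over
  Z[X] can be specialised both at \<omega> and at 1.\<close>

lemma (in comm_ring_hom) hom_divdiff: "hom (divdiff x a j) = divdiff (\<lambda>i. hom (x i)) a j"
  by (induction x a j rule: divdiff.induct) (auto simp: hom_distribs)

lemma newton_basis_node_eq_0: "i < a \<Longrightarrow> newton_basis x a (x i) = 0"
  unfolding newton_basis_def by (rule prod_zero) auto

text \<open>Induction on \<open>j\<close>, using y N_a(y) = N_(a+1)(y) + x_a N_a(y) for the Newton
  basis N. Either alternative of the assumption kills the one term that leaves the range, N_n(y)
  times \<open>divdiff x (n - 1) j\<close>.\<close>

lemma newton_expansion:
  assumes "0 < n" and "newton_basis x n y = 0 \<or> j < n"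
  shows "y ^ j = (\<Sum>a<n. newton_basis x a y * divdiff x a j)"
  using assms(2)
proof (induction j)
  case 0
  have "(\<Sum>a<n. newton_basis x a y * divdiff x a 0) =
        (\<Sum>a<n. if a = 0 then 1 else 0)"
    by (rule sum.cong) (auto simp: newton_basis_def gr0_conv_Suc)
  with assms(1) show ?case by simp
next
  case (Suc j)
  obtain m where n: "n = Suc m" using assms(1) gr0_conv_Suc by auto
  let ?N = "\<lambda>a. newton_basis x a y" and ?D = "divdiff x"
  have rest: "?N (Suc m) * ?D m j = 0"
    using Suc.prems n by (auto simp: divdiff_eq_0)
  have step: "?N (Suc a) = (y - x a) * ?N a" for a
    by (simp add: newton_basis_def mult.commute)
  have "y ^ Suc j = y * (\<Sum>a<n. ?N a * ?D a j)"
    using Suc by auto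
  also have "\<dots> = (\<Sum>a<n. ?N (Suc a) * ?D a j) + (\<Sum>a<n. x a * ?N a * ?D a j)"
    by (simp add: sum_distrib_left sum.distrib [symmetric] step algebra_simps)
  also have "(\<Sum>a<n. ?N (Suc a) * ?D a j) = (\<Sum>a<m. ?N (Suc a) * ?D a j)"
    using rest by (simp add: n)
  also have "\<dots> + (\<Sum>a<n. x a * ?N a * ?D a j) = (\<Sum>a<n. ?N a * ?D a (Suc j))"
    unfolding n by (simp add: sum.lessThan_Suc_shift sum.distrib algebra_simps del: sum.lessThan_Suc)
  finally show ?case .
qed

text \<open>Points \<open>y\<close> and nodes \<open>x\<close> are kept separate to cover two uses:
  points that are nodes, with any exponents, and any points, with exponents below
  \<open>n\<close>.\<close>

lemma det_newton_expansion:
  assumes "\<And>i b. i < n \<Longrightarrow> b < n \<Longrightarrow> newton_basis x n (y i) = 0 \<or> e b < n"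
  shows "det (mat n n (\<lambda>(i, b). y i ^ e b)) =
         det (mat n n (\<lambda>(i, a). newton_basis x a (y i))) * det (mat n n (\<lambda>(a, b). divdiff x a (e b)))"
proof -
  have "mat n n (\<lambda>(i, b). y i ^ e b) =
      mat n n (\<lambda>(i, a). newton_basis x a (y i)) * mat n n (\<lambda>(a, b). divdiff x a (e b))"
  proof (rule eq_matI)
    fix i b
    assume "i < dim_row (mat n n (\<lambda>(i, a). newton_basis x a (y i)) * mat n n (\<lambda>(a, b). divdiff x a (e b)))"
      and "b < dim_col (mat n n (\<lambda>(i, a). newton_basis x a (y i)) * mat n n (\<lambda>(a, b). divdiff x a (e b)))"
    hence "i < n" "b < n" by auto
    with newton_expansion[of n x "y i" "e b"] assms[of i b]
    show "mat n n (\<lambda>(i, b). y i ^ e b) $$ (i, b) =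
      (mat n n (\<lambda>(i, a). newton_basis x a (y i)) * mat n n (\<lambda>(a, b). divdiff x a (e b))) $$ (i, b)"
      by (simp add: scalar_prod_def atLeast0LessThan)
  qed auto
  thus ?thesis by (simp add: det_mult[of _ n])
qed

lemma det_newton_basis_nodes:
  "det (mat n n (\<lambda>(i, a). newton_basis x a (x i))) = (\<Prod>i<n. newton_basis x i (x i))"
  by (subst det_lower_triangular[of n])
     (auto simp: prod_list_diag_prod newton_basis_node_eq_0 atLeast0LessThan)

lemma det_powers_eq:
  "det (mat n n (\<lambda>(i, b). x i ^ e b)) =
   (\<Prod>i<n. newton_basis x i (x i)) * det (mat n n (\<lambda>(a, b). divdiff x a (e b)))"
  using det_newton_expansion[of n x x e]
  by (simp add: newton_basis_node_eq_0 det_newton_basis_nodes)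

lemma det_divdiff_upto: "det (mat n n (\<lambda>(a, b). divdiff x a b)) = 1"
  by (subst det_upper_triangular[of _ n])
     (auto simp: prod_list_diag_prod divdiff_eq_0 divdiff_diag)

section \<open>Binomial determinants modulo a prime\<close>

text \<open>At the nodes 0, 1, 2, ... the Newton basis consists of falling factorials; over
  \<open>int\<close> a zero factor settles the case j < a.\<close>

lemma newton_basis_of_nat:
  "newton_basis of_nat a (of_nat j) = (of_nat (fact a * (j choose a)) :: int)"
proof -
  have "newton_basis of_nat a (of_nat j) = (\<Prod>k<a. int j - int k)"
    by (simp add: newton_basis_def)
  also have "\<dots> = of_nat (fact a * (j choose a))"
  proof (induction a)
    case (Suc a)
    have "(\<Prod>k<Suc a. int j - int k) = int (fact a * (j choose a)) * (int j - int a)"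
      using Suc by simp
    also have "\<dots> = int (fact a) * (int (j choose a) * (int j - int a))"
      by simp
    also have "int (j choose a) * (int j - int a) = int (Suc a) * int (j choose Suc a)"
    proof (cases "a \<le> j")
      case True
      have "(j choose a) * (j - a) = Suc a * (j choose Suc a)"
        by (metis binomial_absorb_comp binomial_absorption mult.commute)
      thus ?thesis using True by (metis of_nat_diff of_nat_mult)
    qed (simp add: binomial_eq_0)
    finally show ?case by (simp add: algebra_simps)
  qed auto
  finally show ?thesis .
qed

lemma not_dvd_det_choose:
  assumes p: "prime (p::nat)" and lt: "\<And>b. b < n \<Longrightarrow> e b < p" and inj: "inj_on e {..<n}"
  shows "\<not> int p dvd det (mat n n (\<lambda>(a, b). int (e b choose a)))"
proof
  let ?C = "mat n n (\<lambda>(a, b). int (e b choose a))"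
  let ?y = "\<lambda>b. int (e b)"
  let ?F = "mat n n (\<lambda>(b, a). newton_basis int a (?y b))"
  assume dvd: "int p dvd det ?C"
  have "?F = transpose_mat ?C * mat_diag n (\<lambda>a. fact a)"
    by (rule eq_matI) (auto simp: newton_basis_of_nat mat_diag_mult_right[of _ n])
  hence "det ?F = det ?C * det (mat_diag n (\<lambda>a. fact a :: int))"
    by (simp add: det_mult[of _ n] det_transpose[of _ n])
  with dvd have "int p dvd det ?F" by simp
  \<comment> \<open>With nodes 0, ..., n-1 and exponents below \<open>n\<close>, the second factor
    is unitriangular. Expanding the same power matrix with its own points as nodes then yields the
    Vandermonde product.\<close>
  also have "det ?F = det (mat n n (\<lambda>(i, b). ?y i ^ b))"
    using det_newton_expansion[of n int ?y "\<lambda>b. b"] by (simp add: det_divdiff_upto)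
  also have "\<dots> = (\<Prod>i<n. newton_basis ?y i (?y i))"
    using det_powers_eq[of n ?y "\<lambda>b. b"] by (simp add: det_divdiff_upto)
  finally obtain i k where ik: "i < n" "k < i" "int p dvd int (e i) - int (e k)"
    using p by (auto simp: newton_basis_def prime_dvd_prod_iff)
  have "[e i = e k] (mod p)"
    using ik(3) by (simp add: cong_iff_dvd_diff cong_int_iff[symmetric])
  hence "e i = e k"
    using lt[of i] lt[of k] ik by (simp add: cong_def)
  with inj ik show False by (auto dest: inj_onD)
qed

section \<open>Integer polynomials vanishing at a root of unity\<close>

lemma comm_ring_hom_poly_of_int_poly:
  "comm_ring_hom (\<lambda>G. poly (map_poly of_int G) (w :: 'a::comm_ring_1))"
  by unfold_locales (auto simp: hom_distribs)

lemma comm_ring_hom_poly: "comm_ring_hom (\<lambda>G. poly G (w :: 'a::comm_ring_1))"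
  by unfold_locales auto

lemma freshmans_dream_mod:
  fixes x y :: "'a::comm_ring_1"
  assumes "prime p"
  shows "\<exists>k. (x + y) ^ p = x ^ p + y ^ p + of_nat p * k"
proof -
  have "p > 0" using assms prime_gt_0_nat by blast
  let ?t = "\<lambda>k. of_nat (p choose k) * x ^ k * y ^ (p - k)"
  have split: "{..p} = insert 0 (insert p {0<..<p})" by auto
  have "(x + y) ^ p = (\<Sum>k\<le>p. ?t k)" by (rule binomial_ring)
  also have "\<dots> = x ^ p + y ^ p + (\<Sum>k\<in>{0<..<p}. ?t k)"
    unfolding split using \<open>p > 0\<close> by (simp add: add_ac)
  also have "(\<Sum>k\<in>{0<..<p}. ?t k) =
      (\<Sum>k\<in>{0<..<p}. of_nat p * (of_nat ((p choose k) div p) * x ^ k * y ^ (p - k)))"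
  proof (rule sum.cong)
    fix k assume k: "k \<in> {0<..<p}"
    hence "p dvd p choose k" by (intro dvd_choose_prime) (use assms in auto)
    hence "p choose k = p * ((p choose k) div p)" by simp
    hence "(of_nat (p choose k) :: 'a) = of_nat p * of_nat ((p choose k) div p)"
      by (metis of_nat_mult)
    thus "?t k = of_nat p * (of_nat ((p choose k) div p) * x ^ k * y ^ (p - k))"
      by (simp add: mult.assoc)
  qed simp
  finally show ?thesis unfolding sum_distrib_left [symmetric] by blast
qed

text \<open>Modulo \<open>p\<close>, taking \<open>p\<close>-th powers is additive, so the claim
  passes from an integer to both of its neighbours.\<close>

lemma fermat_int: "prime p \<Longrightarrow> int p dvd a ^ p - a"
proof (induction a rule: int_induct[where k = 0])
  case base
  thus ?case using prime_gt_0_nat[of p] by (simp add: power_0_left)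
next
  case (step1 i)
  obtain k where "(i + 1) ^ p = i ^ p + 1 ^ p + int p * k"
    using freshmans_dream_mod[of p i 1] step1.prems by auto
  hence "(i + 1) ^ p - (i + 1) = (i ^ p - i) + int p * k" by simp
  moreover have "int p dvd (i ^ p - i) + int p * k" using step1 by simp
  ultimately show ?case by metis
next
  case (step2 i)
  obtain k where "(i - 1 + 1) ^ p = (i - 1) ^ p + 1 ^ p + int p * k"
    using freshmans_dream_mod[of p "i - 1" 1] step2.prems by auto
  hence "(i - 1) ^ p - (i - 1) = (i ^ p - i) - int p * k" by simp
  moreover have "int p dvd (i ^ p - i) - int p * k" using step2 by simp
  ultimately show ?case by metis
qed

text \<open>Modulo \<open>p\<close>, taking \<open>p\<close>-th powers is additive, fixes the
  integer coefficients and sends \<open>w\<close> to 1. The error stays in p Z[w] because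
  \<open>K\<close> is an integer polynomial.\<close>

lemma poly_root_of_unity_power_prime:
  fixes w :: "'a::comm_ring_1"
  assumes p: "prime p" and w: "w ^ p = 1"
  shows "\<exists>K. poly (map_poly of_int G) w ^ p =
             of_int (poly G 1) + of_nat p * poly (map_poly of_int K) w"
proof (induction G)
  case 0
  show ?case using p prime_gt_0_nat[of p] by (intro exI[of _ 0]) (simp add: power_0_left)
next
  case (pCons a G)
  interpret ev: comm_ring_hom "\<lambda>G. poly (map_poly of_int G) w"
    by (rule comm_ring_hom_poly_of_int_poly)
  let ?e = "\<lambda>G. poly (map_poly of_int G) w"
  obtain K where K: "?e G ^ p = of_int (poly G 1) + of_nat p * ?e K" using pCons.IH by blast
  obtain L where L: "([:a:] + monom 1 1 * G) ^ p = [:a:] ^ p + (monom 1 1 * G) ^ p + of_nat p * L"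
    using freshmans_dream_mod[OF p] by blast
  obtain m where m: "a ^ p = a + int p * m"
    using fermat_int[OF p, of a] by (auto simp: dvd_def algebra_simps)
  have e: "pCons a G = [:a:] + monom 1 1 * G"
    by (simp add: monom_altdef)
  have X: "?e (monom 1 1) = w" by (simp add: poly_monom)
  have c: "?e [:c:] = of_int c" for c by (cases "c = 0") (auto simp: map_poly_pCons)
  have "?e (pCons a G) ^ p = ?e (([:a:] + monom 1 1 * G) ^ p)"
    unfolding e by (simp only: ev.hom_power)
  also have "\<dots> = of_int a ^ p + w ^ p * ?e G ^ p + of_nat p * ?e L"
    unfolding L by (simp only: ev.hom_power ev.hom_add ev.hom_mult X c ev.hom_of_nat power_mult_distrib)
  also have "of_int a ^ p = (of_int (a + int p * m) :: 'a)"
    by (simp only: m[symmetric] of_int_power)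
  also have "\<dots> + w ^ p * ?e G ^ p + of_nat p * ?e L =
      of_int (poly (pCons a G) 1) + of_nat p * ?e ([:m:] + K + L)"
    unfolding w K by (simp add: ev.hom_add c algebra_simps)
  finally show ?case by blast
qed

lemma poly_root_of_unity_reduce:
  fixes w :: "'a::comm_ring_1"
  assumes "0 < p" and w: "w ^ p = 1"
  shows "\<exists>a. poly (map_poly of_int G) w = (\<Sum>j<p. of_int (a j) * w ^ j)"
proof (induction G)
  case 0
  show ?case by (intro exI[of _ "\<lambda>_. 0"]) simp
next
  case (pCons c G)
  obtain q where q: "p = Suc q" using assms(1) gr0_conv_Suc by auto
  obtain a where a: "poly (map_poly of_int G) w = (\<Sum>j<p. of_int (a j) * w ^ j)"
    using pCons.IH by blast
  have wq: "w * w ^ q = 1" using w q by simp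
  have "poly (map_poly of_int (pCons c G)) w = of_int c + w * (\<Sum>j<p. of_int (a j) * w ^ j)"
    using pCons by (simp add: a map_poly_pCons)
  also have "\<dots> = of_int c + of_int (a q) * (w * w ^ q) + (\<Sum>j<q. of_int (a j) * w ^ Suc j)"
    by (simp add: q sum_distrib_left algebra_simps)
  \<comment> \<open>Multiplication by \<open>w\<close> shifts the coefficients cyclically: the top
    one, \<open>a q\<close>, wraps around to the constant term.\<close>
  also have "\<dots> = (\<Sum>j<p. of_int (case j of 0 \<Rightarrow> c + a q | Suc i \<Rightarrow> a i) * w ^ j)"
    unfolding q wq by (simp add: sum.lessThan_Suc_shift del: sum.lessThan_Suc)
  finally show ?case by blast
qed

lemma det_cong:
  fixes A B :: "int mat"
  assumes "A \<in> carrier_mat n n" "B \<in> carrier_mat n n"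
    and "\<And>i j. i < n \<Longrightarrow> j < n \<Longrightarrow> [A $$ (i, j) = B $$ (i, j)] (mod m)"
  shows "[det A = det B] (mod m)"
  unfolding det_def'[OF assms(1)] det_def'[OF assms(2)]
  by (intro cong_sum cong_mult cong_prod cong_refl assms(3))
     (auto simp: permutes_in_image[of _ "{0..<n}", unfolded atLeastLessThan_iff])

text \<open>Since \<open>0 = G(w)\<^sup>p = G(1) + p K(w)\<close>, the integer \<open>G(1)\<close> is \<open>-p\<close> times an element of
  \<open>\<int>[w]\<close>. Writing multiplication by \<open>K(w)\<close> as an integer matrix \<open>A\<close> on the powers of \<open>w\<close>, the matrix
  \<open>G(1) + p A\<close> is singular, and its determinant is \<open>G(1)\<^sup>p\<close> modulo \<open>p\<close>.\<close>

lemma prime_dvd_poly_1_if_root_of_unity: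
  fixes w :: "'a::{field_char_0}"
  assumes p: "prime p" and w: "w ^ p = 1" and G: "poly (map_poly of_int G) w = 0"
  shows "int p dvd poly G 1"
proof -
  interpret ev: comm_ring_hom "\<lambda>G. poly (map_poly of_int G) w"
    by (rule comm_ring_hom_poly_of_int_poly)
  let ?e = "\<lambda>G. poly (map_poly of_int G) w"
  have p0: "0 < p" using p prime_gt_0_nat by blast
  obtain K where K: "of_int (poly G 1) + of_nat p * ?e K = 0"
    using poly_root_of_unity_power_prime[OF p w, of G] G p0 by (auto simp: power_0_left)
  have "\<forall>i. \<exists>a. ?e (monom 1 i * K) = (\<Sum>j<p. of_int (a j) * w ^ j)"
    using poly_root_of_unity_reduce[OF p0 w] by blast
  then obtain A where A: "?e (monom 1 i * K) = (\<Sum>j<p. of_int (A i j) * w ^ j)" for i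
    by metis
  have A': "w ^ i * ?e K = (\<Sum>j<p. of_int (A i j) * w ^ j)" for i
    using A[of i] by (simp add: ev.hom_mult poly_monom)
  define M where "M = mat p p (\<lambda>(i, j). int p * A i j + (if i = j then poly G 1 else 0))"
  define v where "v = vec p (\<lambda>j. w ^ j)"
  have M: "M \<in> carrier_mat p p" by (simp add: M_def)
  have "map_mat of_int M *\<^sub>v v = 0\<^sub>v p"
  proof (rule eq_vecI)
    fix i assume "i < dim_vec (0\<^sub>v p :: 'a vec)"
    hence i: "i < p" by simp
    hence "(map_mat of_int M *\<^sub>v v) $ i =
        (\<Sum>j<p. of_int (int p * A i j + (if i = j then poly G 1 else 0)) * w ^ j)"
      by (simp add: M_def v_def scalar_prod_def atLeast0LessThan)
    also have "\<dots> = (\<Sum>j<p. of_nat p * (of_int (A i j) * w ^ j) + (if i = j then of_int (poly G 1) * w ^ j else 0))"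
      by (rule sum.cong) (auto simp: algebra_simps)
    also have "\<dots> = of_nat p * (\<Sum>j<p. of_int (A i j) * w ^ j) + of_int (poly G 1) * w ^ i"
      using i by (simp add: sum.distrib sum_distrib_left)
    also have "\<dots> = w ^ i * (of_int (poly G 1) + of_nat p * ?e K)"
      unfolding A' [symmetric] by (simp add: algebra_simps)
    finally show "(map_mat of_int M *\<^sub>v v) $ i = (0\<^sub>v p :: 'a vec) $ i"
      using i K by simp
  qed (simp add: M_def)
  moreover have "v \<noteq> 0\<^sub>v p"
  proof
    assume "v = 0\<^sub>v p"
    hence "v $ 0 = 0\<^sub>v p $ 0" by simp
    thus False using p0 by (simp add: v_def)
  qed
  ultimately have "det (map_mat of_int M :: 'a mat) = 0"
    using M by (subst det_0_iff_vec_prod_zero[of _ p]) (auto simp: v_def intro!: exI[of _ v])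
  \<comment> \<open>Characteristic 0 makes \<open>of_int\<close> injective, which brings the
    vanishing back to the integers.\<close>
  hence "det M = 0" by simp
  moreover have "[det M = det (poly G 1 \<cdot>\<^sub>m 1\<^sub>m p)] (mod int p)"
    by (rule det_cong[of _ p]) (auto simp: M_def cong_def)
  ultimately have "int p dvd poly G 1 ^ p"
    by (simp add: cong_0_iff cong_sym_eq[of 0])
  thus ?thesis using p by (meson prime_dvd_power prime_nat_int_transfer)
qed

section \<open>Chebotarev's theorem\<close>

theorem mainTheorem1:
  fixes p :: nat and \<omega> :: complex and I J :: "int set" and r c :: "nat \<Rightarrow> int"
  assumes "prime p"
    and "primitive_root_of_unity p \<omega>"
    and "I \<subseteq> carrier (prime_field p)"
    and "J \<subseteq> carrier (prime_field p)"
    and "card I = card J"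
    and "bij_betw r {..<card I} I"
    and "bij_betw c {..<card J} J"
  shows "det (fourier_submatrix p \<omega> I J r c) \<noteq> 0"
proof
  assume det0: "det (fourier_submatrix p \<omega> I J r c) = 0"
  define n where "n = card I"
  define s where "s = (\<lambda>a. nat (r a))"
  define e where "e = (\<lambda>b. nat (c b))"
  have w: "\<omega> ^ p = 1" using assms(2) by (simp add: primitive_root_of_unity_def)
  have s: "r a = int (s a)" "s a < p" if "a < n" for a
    using that bij_betwE[OF assms(6)] assms(3) by (force simp: n_def s_def residue_ring_def)+
  have e: "c a = int (e a)" "e a < p" if "a < n" for a
    using that bij_betwE[OF assms(7)] assms(4,5) by (force simp: n_def e_def residue_ring_def)+
  have inj_s: "inj_on s {..<n}"
    using bij_betw_imp_inj_on[OF assms(6)] s(1) by (force simp: inj_on_def n_def)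
  have inj_e: "inj_on e {..<n}"
    using bij_betw_imp_inj_on[OF assms(7)] e(1) assms(5) by (force simp: inj_on_def n_def)
  have inj_w: "inj_on (\<lambda>k. \<omega> ^ k) {..<p}"
  proof (rule linorder_inj_onI)
    fix k l assume kl: "k < l" "k \<in> {..<p}" "l \<in> {..<p}"
    have nz: "\<omega> \<noteq> 0" using w prime_gt_0_nat[OF assms(1)] by (auto simp: power_0_left)
    have "\<omega> ^ l = \<omega> ^ k * \<omega> ^ (l - k)" using kl by (simp flip: power_add)
    moreover have "\<omega> ^ (l - k) \<noteq> 1"
      using assms(2) kl by (simp add: primitive_root_of_unity_def)
    ultimately show "\<omega> ^ k \<noteq> \<omega> ^ l" using nz by auto
  qed auto
  define x where "x = (\<lambda>a. \<omega> ^ s a)"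
  \<comment> \<open>Formal version of the nodes: \<open>X a\<close> becomes \<open>x a\<close> at
    \<omega> and 1 at 1.\<close>
  define X where "X = (\<lambda>a. monom (1::int) (s a))"
  have "fourier_submatrix p \<omega> I J r c = mat n n (\<lambda>(a, b). x a ^ e b)"
  proof (rule eq_matI)
    fix a b assume "a < dim_row (mat n n (\<lambda>(a, b). x a ^ e b))" "b < dim_col (mat n n (\<lambda>(a, b). x a ^ e b))"
    hence ab: "a < n" "b < n" by auto
    have "\<omega> powi (r a \<otimes>\<^bsub>prime_field p\<^esub> c b) = \<omega> powi (r a * c b)"
      by (rule power_residue_well_defined[OF assms(2), symmetric]) simp
    also have "\<dots> = x a ^ e b"
      using s e ab by (simp add: x_def power_mult flip: of_nat_mult)
    finally show "fourier_submatrix p \<omega> I J r c $$ (a, b) = mat n n (\<lambda>(a, b). x a ^ e b) $$ (a, b)"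
      using ab assms(5) by (simp add: fourier_submatrix_def n_def)
  qed (use assms(5) in \<open>auto simp: fourier_submatrix_def n_def\<close>)
  with det0 have "(\<Prod>i<n. newton_basis x i (x i)) * det (mat n n (\<lambda>(a, b). divdiff x a (e b))) = 0"
    by (simp add: det_powers_eq)
  \<comment> \<open>Primitivity of \<omega> enters here: distinct nodes make the triangular factor
    invertible.\<close>
  moreover have "x i \<noteq> x k" if "i < n" "k < i" for i k
    using that inj_onD[OF inj_w, of "s i" "s k"] inj_onD[OF inj_s, of i k] s(2)
    by (auto simp: x_def)
  hence "(\<Prod>i<n. newton_basis x i (x i)) \<noteq> 0"
    by (auto simp: newton_basis_def)
  ultimately have D0: "det (mat n n (\<lambda>(a, b). divdiff x a (e b))) = 0" by simp
  interpret ev: comm_ring_hom "\<lambda>G. poly (map_poly of_int G) \<omega>"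
    by (rule comm_ring_hom_poly_of_int_poly)
  define G where "G = det (mat n n (\<lambda>(a, b). divdiff X a (e b)))"
  have "poly (map_poly of_int G) \<omega> = det (map_mat (\<lambda>G. poly (map_poly of_int G) \<omega>) (mat n n (\<lambda>(a, b). divdiff X a (e b))))"
    by (simp only: G_def ev.hom_det)
  also have "map_mat (\<lambda>G. poly (map_poly of_int G) \<omega>) (mat n n (\<lambda>(a, b). divdiff X a (e b))) =
      mat n n (\<lambda>(a, b). divdiff x a (e b))"
    by (rule eq_matI) (auto simp: ev.hom_divdiff X_def x_def poly_monom)
  finally have "int p dvd poly G 1"
    using prime_dvd_poly_1_if_root_of_unity[OF assms(1) w] D0 by simp
  also have "poly G 1 = det (map_mat (\<lambda>G. poly G 1) (mat n n (\<lambda>(a, b). divdiff X a (e b))))"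
    by (simp only: G_def comm_ring_hom.hom_det[OF comm_ring_hom_poly])
  also have "map_mat (\<lambda>G. poly G 1) (mat n n (\<lambda>(a, b). divdiff X a (e b))) =
      mat n n (\<lambda>(a, b). int (e b choose a))"
    by (rule eq_matI) (auto simp: comm_ring_hom.hom_divdiff[OF comm_ring_hom_poly] X_def poly_monom divdiff_const_1)
  finally show False
    using not_dvd_det_choose[OF assms(1) e(2) inj_e] by blast
qed

end
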